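(* Let $G$ be a triangle-free Toeplitz-row graph. Then the following are true: (a) there are no three cycles of pairwise different lengths in $G$; (b) there are no seven path components of pairwise different lengths in $G$.
   Context: Write $[m]=\{1,\dots,m\}$. For disjoint subsets $\alpha,\beta\subseteq[n-1]$, not both empty, $T_n\langle\alpha;\beta\rangle$ denotes the $n\times n$ $(0,1)$-matrix $(t_{u,v})$ with $t_{u,v}=1$ if and only if $u-v\in\alpha$ or $v-u\in\beta$. The row graph $\mathrm{RG}(T)$ of an $n\times n$ $(0,1)$-matrix $T=(t_{u,v})$ is the simple graph with vertex set $[n]$ in which two distinct vertices $u,v$ are adjacent if and only if $t_{u,k}=t_{v,k}=1$ for some $k\in[n]$. A Toeplitz-row graph is a graph (isomorphic to one) of the form $\mathrm{RG}(T)$ for some $T=T_n\langle\alpha;\beta\rangle$. A path component is a connected component that is a path; an isolated vertex counts as a path of length $0$. *)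

theory Defs
  imports "Graph_Theory.Graph_Theory"
begin

text \<open>
  Finite simple graphs are the symmetric loop-free pair digraphs of \<^theory>\<open>Graph_Theory.Pair_Digraph\<close>
  (locale \<^locale>\<open>pair_graph\<close>): every edge is represented by its two arcs.
  Matrices of size \<open>n \<times> n\<close> are functions of two indices from \<open>{1..n}\<close>; their values at
  other indices are irrelevant.
\<close>

definition toeplitz_matrix :: "nat set \<Rightarrow> nat set \<Rightarrow> nat \<Rightarrow> nat \<Rightarrow> nat" where
  "toeplitz_matrix \<alpha> \<beta> u v =
    (if int u - int v \<in> int ` \<alpha> \<or> int v - int u \<in> int ` \<beta> then 1 else 0)"

definition row_graph :: "nat \<Rightarrow> (nat \<Rightarrow> nat \<Rightarrow> nat) \<Rightarrow> nat pair_pre_digraph" where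
  "row_graph n T =
    \<lparr> pverts = {1..n},
      parcs = {(u, v). u \<in> {1..n} \<and> v \<in> {1..n} \<and> u \<noteq> v \<and>
                 (\<exists>k\<in>{1..n}. T u k = 1 \<and> T v k = 1)} \<rparr>"

lemma pair_graph_row_graph: "pair_graph (row_graph n T)"
proof unfold_locales
  show "finite (parcs (row_graph n T))"
    by (rule finite_subset[of _ "{1..n} \<times> {1..n}"]) (auto simp: row_graph_def)
  show "symmetric (with_proj (row_graph n T))"
    by (auto simp: symmetric_def row_graph_def intro!: symI)
qed (auto simp: row_graph_def)

definition toeplitz_row_graph :: "'a pair_pre_digraph \<Rightarrow> bool" where
  "toeplitz_row_graph G \<longleftrightarrow>
    (\<exists>n \<alpha> \<beta>. \<alpha> \<subseteq> {1..n - 1} \<and> \<beta> \<subseteq> {1..n - 1} \<and> \<alpha> \<inter> \<beta> = {} \<and> \<not> (\<alpha> = {} \<and> \<beta> = {}) \<and>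
       digraph_iso (with_proj (row_graph n (toeplitz_matrix \<alpha> \<beta>))) (with_proj G))"

text \<open>
  The library's notion of cycle is the one for digraphs, where traversing an edge back and forth
  is a cycle of length 2; requiring length at least 3 excludes exactly these.
\<close>

definition graph_cycle :: "'a pair_pre_digraph \<Rightarrow> ('a \<times> 'a) list \<Rightarrow> bool" where
  "graph_cycle G p \<longleftrightarrow> pre_digraph.cycle (with_proj G) p \<and> 3 \<le> length p"

definition triangle_free :: "'a pair_pre_digraph \<Rightarrow> bool" where
  "triangle_free G \<longleftrightarrow> \<not> (\<exists>p. graph_cycle G p \<and> length p = 3)"

text \<open>
  Connected components are maximal connected subgraphs. Maximality forces them to be induced, hence
  symmetric, although \<^const>\<open>subgraph\<close> alone would admit one arc of an edge without the other.
\<close>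

definition graph_component :: "'a pair_pre_digraph \<Rightarrow> ('a, 'a \<times> 'a) pre_digraph \<Rightarrow> bool" where
  "graph_component G H \<longleftrightarrow> pre_digraph.max_subgraph (with_proj G) connected H"

text \<open>The empty walk gives the one-vertex path, of length 0.\<close>

definition is_path_of_length :: "('a, 'a \<times> 'a) pre_digraph \<Rightarrow> nat \<Rightarrow> bool" where
  "is_path_of_length H l \<longleftrightarrow>
    (\<exists>u p v. pre_digraph.apath H u p v \<and> length p = l \<and>
       verts H = set (pre_digraph.awalk_verts H u p) \<and>
       arcs H = set p \<union> prod.swap ` set p)"

end

theory Submission
  imports Defs
begin

text \<open>
  Number the vertices by the rows \<open>1, \<dots>, n\<close> of a Toeplitz matrix. If the row graph has no triangle,
  every column has at most two ones. Since reflection in the antidiagonal maps the matrix to itself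
  and columns to rows, every row has at most two ones as well. A vertex therefore has at most two
  neighbours: every component is a path or a cycle, and a cycle fills its component. So it suffices
  to bound the number of different component sizes, over all components for part (b) and over the
  2-regular ones for part (a).

  Translation along the diagonals preserves the ones of the matrix, so \<open>u\<close> and \<open>v\<close> are adjacent iff
  \<open>u - 1\<close> and \<open>v - 1\<close> are, unless a row or a column crosses the border of the matrix. Hence a
  component can be shifted downwards, as a whole and without change of its size, until it meets a
  row at which the shift breaks down. This can happen only at the following rows.
  \<^item> Row 1, which has no predecessor.
  \<^item> The rows with a one in column 1. They are at most two, and if two then adjacent, so they account
    for at most one component.
  \<^item> The rows \<open>w\<close> such that \<open>w - 1\<close> has a one in column \<open>n\<close>. They are at most two.
  \<^item> The rows \<open>w\<close> such that \<open>w - 1\<close> is a neighbour of \<open>n\<close>. They are at most two.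

  This leaves at most \<open>1 + 1 + 2 + 2 = 6\<close> component sizes (\<open>card_component_sizes\<close>). The last two
  kinds of rows are those where \<open>w - 1\<close> may have a neighbour that is not the predecessor of a
  neighbour of \<open>w\<close>. In a 2-regular component the predecessors of the two neighbours of \<open>w\<close> already
  exhaust the possible neighbours of \<open>w - 1\<close>, so only the first two kinds count and at most two sizes
  remain (\<open>card_two_regular_component_sizes\<close>).
\<close>

section \<open>Neighbourhoods and components\<close>

text \<open>
  The hypothesis is only demanded on the component of \<open>v\<close>, so that \<open>g\<close> may be an isomorphism of
  graphs as well as a translation that respects adjacency in just one part of a graph.
\<close>

lemma component_image:
  assumes "\<And>w. w \<in> r\<^sup>* `` {v} \<Longrightarrow> s `` {g w} = g ` (r `` {w})"
  shows "s\<^sup>* `` {g v} = g ` (r\<^sup>* `` {v})"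
proof (intro subset_antisym subsetI)
  fix y assume "y \<in> s\<^sup>* `` {g v}"
  then have "(g v, y) \<in> s\<^sup>*" by simp
  then show "y \<in> g ` (r\<^sup>* `` {v})"
  proof (induction rule: rtrancl_induct)
    case base
    show ?case by blast
  next
    case (step y z)
    then obtain w where w: "w \<in> r\<^sup>* `` {v}" "y = g w" by blast
    with step.hyps(2) assms[OF w(1)] obtain w' where "(w, w') \<in> r" "z = g w'" by blast
    with w(1) show ?case by (blast intro: rtrancl_into_rtrancl)
  qed
next
  fix y assume "y \<in> g ` (r\<^sup>* `` {v})"
  then obtain w where w: "(v, w) \<in> r\<^sup>*" "y = g w" by blast
  from w(1) have "(g v, g w) \<in> s\<^sup>*"
  proof (induction rule: rtrancl_induct)
    case (step w w')
    then have "g w' \<in> g ` (r `` {w})" by blast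
    then have "(g w, g w') \<in> s" using assms[of w] step.hyps(1) by blast
    with step.IH show ?case by (rule rtrancl_into_rtrancl)
  qed simp
  with w(2) show "y \<in> s\<^sup>* `` {g v}" by simp
qed

lemma component_eq_closed_connected:
  assumes "r `` S \<subseteq> S" "S \<subseteq> r\<^sup>* `` {x}" "x \<in> S"
  shows "r\<^sup>* `` {x} = S"
proof -
  have "y \<in> S" if "(x, y) \<in> r\<^sup>*" for y
    using that by (induction rule: rtrancl_induct) (use assms in blast)+
  with assms(2) show ?thesis by blast
qed

lemma component_eq_if_reachable:
  assumes "sym r" "(x, y) \<in> r\<^sup>*"
  shows "r\<^sup>* `` {x} = r\<^sup>* `` {y}"
  using assms sym_rtrancl[OF assms(1)] by (auto dest: symD intro: rtrancl_trans)

definition two_regular_component :: "('a \<times> 'a) set \<Rightarrow> 'a \<Rightarrow> bool" where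
  "two_regular_component r v \<longleftrightarrow> (\<forall>w\<in>r\<^sup>* `` {v}. card (r `` {w}) = 2)"

section \<open>Sparse Toeplitz patterns\<close>

text \<open>
  The matrix enters only through the set \<open>D\<close> of its nonzero diagonals, where \<open>\<alpha>\<close> contributes the
  positive elements and \<open>\<beta>\<close> the negative ones.
\<close>

locale sparse_toeplitz =
  fixes n :: nat and D :: "int set"
  assumes column_le_2: "k \<in> {1..n} \<Longrightarrow> card {u \<in> {1..n}. int u - int k \<in> D} \<le> 2"
begin

definition entries :: "(nat \<times> nat) set" where
  "entries = {(u, k). u \<in> {1..n} \<and> k \<in> {1..n} \<and> int u - int k \<in> D}"

definition adj :: "(nat \<times> nat) set" where
  "adj = {(u, v). u \<noteq> v \<and> (\<exists>k. (u, k) \<in> entries \<and> (v, k) \<in> entries)}"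

definition column :: "nat \<Rightarrow> nat set" where
  "column k = {u. (u, k) \<in> entries}"

definition component_size :: "nat \<Rightarrow> nat" where
  "component_size v = card (adj\<^sup>* `` {v})"

lemma finite_column: "finite (column k)"
  by (rule finite_subset[of _ "{1..n}"]) (auto simp: column_def entries_def)

lemma card_column: "card (column k) \<le> 2"
proof (cases "k \<in> {1..n}")
  case True
  then have "column k = {u \<in> {1..n}. int u - int k \<in> D}" by (auto simp: column_def entries_def)
  with column_le_2[OF True] show ?thesis by simp
qed (auto simp: column_def entries_def)

text \<open>
  A Toeplitz pattern is symmetric about the antidiagonal, which exchanges rows and columns.
\<close>

lemma card_row: "card {k. (u, k) \<in> entries} \<le> 2"
proof -
  let ?f = "\<lambda>k. n + 1 - k"
  have "?f ` {k. (u, k) \<in> entries} \<subseteq> column (?f u)"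
    by (auto simp: column_def entries_def algebra_simps of_nat_diff)
  moreover have "inj_on ?f {k. (u, k) \<in> entries}"
    by (rule inj_onI) (auto simp: entries_def)
  ultimately have "card {k. (u, k) \<in> entries} \<le> card (column (?f u))"
    using finite_column by (metis card_inj_on_le)
  with card_column[of "?f u"] show ?thesis by linarith
qed

lemma finite_row: "finite {k. (u, k) \<in> entries}"
  by (rule finite_subset[of _ "{1..n}"]) (auto simp: entries_def)

lemma sym_adj: "sym adj"
  by (auto simp: sym_def adj_def)

lemma adj_bounds: "(u, v) \<in> adj \<Longrightarrow> u \<in> {1..n} \<and> v \<in> {1..n}"
  by (auto simp: adj_def entries_def)

lemma finite_neighbours: "finite (adj `` {u})"
  by (rule finite_subset[of _ "{1..n}"]) (auto dest: adj_bounds)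

lemma component_bounds: "v \<in> {1..n} \<Longrightarrow> w \<in> adj\<^sup>* `` {v} \<Longrightarrow> w \<in> {1..n}"
  using adj_bounds rtranclE by (metis Image_singleton_iff)

text \<open>
  A row has at most two entries, and each of their columns offers at most one further row.
\<close>

lemma card_neighbours: "card (adj `` {u}) \<le> 2"
proof -
  let ?K = "{k. (u, k) \<in> entries}"
  have "adj `` {u} = (\<Union>k\<in>?K. column k - {u})"
    by (auto simp: adj_def column_def)
  then have "card (adj `` {u}) \<le> (\<Sum>k\<in>?K. card (column k - {u}))"
    using card_UN_le[OF finite_row, of "\<lambda>k. column k - {u}"] by presburger
  also have "\<dots> \<le> (\<Sum>k\<in>?K. 1)"
  proof (rule sum_mono)
    fix k assume "k \<in> ?K"
    then have "u \<in> column k" by (simp add: column_def)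
    then show "card (column k - {u}) \<le> 1" using card_column[of k] by simp
  qed
  also have "\<dots> \<le> 2" using card_row[of u] by simp
  finally show ?thesis .
qed

section \<open>Shifting components\<close>

text \<open>
  The ones of \<open>u\<close> and \<open>v\<close> in a common column move one step up their diagonals. The column is the
  same for both, so excluding \<open>u\<close> alone from column 1 keeps it inside the matrix.
\<close>

lemma adj_pred:
  assumes "(u, v) \<in> adj" "u \<noteq> 1" "v \<noteq> 1" "u \<notin> column 1"
  shows "(u - 1, v - 1) \<in> adj"
proof -
  from assms(1) obtain k where k: "u \<noteq> v" "(u, k) \<in> entries" "(v, k) \<in> entries"
    by (auto simp: adj_def)
  with assms have "k \<noteq> 1" "u \<ge> 1" "v \<ge> 1" "k \<ge> 1" by (auto simp: column_def entries_def)
  with k assms have "(u - 1, k - 1) \<in> entries" "(v - 1, k - 1) \<in> entries"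
    by (auto simp: entries_def of_nat_diff)
  with k(1) \<open>u \<ge> 1\<close> \<open>v \<ge> 1\<close> show ?thesis by (auto simp: adj_def)
qed

lemma adj_Suc:
  assumes "(u, v) \<in> adj" "u \<noteq> n" "v \<noteq> n" "u \<notin> column n"
  shows "(Suc u, Suc v) \<in> adj"
proof -
  from assms(1) obtain k where k: "u \<noteq> v" "(u, k) \<in> entries" "(v, k) \<in> entries"
    by (auto simp: adj_def)
  with assms have "k \<noteq> n" by (auto simp: column_def entries_def)
  with k assms have "(Suc u, Suc k) \<in> entries" "(Suc v, Suc k) \<in> entries"
    by (auto simp: entries_def)
  with k(1) show ?thesis by (auto simp: adj_def)
qed

lemma inj_on_pred: "inj_on (\<lambda>w. w - 1) {1..(n::nat)}"
  by (rule inj_onI) auto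

lemma pred_neighbours_subset:
  assumes "w \<notin> {1} \<union> column 1" "1 \<notin> adj `` {w}"
  shows "(\<lambda>w. w - 1) ` (adj `` {w}) \<subseteq> adj `` {w - 1}"
  using assms adj_pred by fastforce

text \<open>
  The rows \<open>w\<close> at which a shift of their component may push a row or a column across the border of
  the matrix: the shift from \<open>w\<close> to \<open>w - 1\<close> across row or column 1, the shift back from \<open>w - 1\<close> to
  \<open>w\<close> across row or column \<open>n\<close>.
\<close>

definition border :: "nat set" where
  "border = {1} \<union> column 1 \<union> Suc ` column n \<union> Suc ` (adj `` {n})"

lemma component_pred:
  assumes "v \<in> {1..n}" "adj\<^sup>* `` {v} \<inter> border = {}"
  shows "adj\<^sup>* `` {v - 1} = (\<lambda>w. w - 1) ` (adj\<^sup>* `` {v})"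
proof (rule component_image)
  fix w assume w: "w \<in> adj\<^sup>* `` {v}"
  then have avoid: "w \<notin> border" using assms(2) by blast
  have nbrs: "adj `` {w} \<subseteq> adj\<^sup>* `` {v}"
    using w by (auto intro: rtrancl_into_rtrancl)
  have w1: "w \<in> {1..n}" "w \<noteq> 1" using component_bounds[OF assms(1) w] avoid
    by (auto simp: border_def)
  show "adj `` {w - 1} = (\<lambda>w. w - 1) ` (adj `` {w})"
  proof (intro subset_antisym subsetI)
    fix x assume "x \<in> adj `` {w - 1}"
    then have x: "(w - 1, x) \<in> adj" by simp
    have suc: "Suc (w - 1) = w" using w1 by auto
    have "x \<noteq> n"
    proof
      assume "x = n"
      then have "w - 1 \<in> adj `` {n}" using x sym_adj by (auto dest: symD)
      then have "Suc (w - 1) \<in> border" unfolding border_def by blast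
      with avoid suc show False by simp
    qed
    moreover have "w - 1 \<notin> column n"
    proof
      assume "w - 1 \<in> column n"
      then have "Suc (w - 1) \<in> border" unfolding border_def by blast
      with avoid suc show False by simp
    qed
    moreover have "w - 1 \<noteq> n" using w1 by auto
    ultimately have "(w, Suc x) \<in> adj" using adj_Suc[OF x] suc by simp
    then show "x \<in> (\<lambda>w. w - 1) ` (adj `` {w})" by force
  next
    fix x assume "x \<in> (\<lambda>w. w - 1) ` (adj `` {w})"
    moreover have "w \<notin> {1} \<union> column 1" "1 \<notin> adj `` {w}"
      using avoid nbrs assms(2) by (auto simp: border_def)
    ultimately show "x \<in> adj `` {w - 1}" using pred_neighbours_subset by blast
  qed
qed

text \<open>
  In a 2-regular component the degree bound alone makes the shift surjective on neighbourhoods: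
  the predecessors of the two neighbours of \<open>w\<close> leave no room for a third neighbour of \<open>w - 1\<close>.
\<close>

lemma two_regular_component_pred:
  assumes "v \<in> {1..n}" "two_regular_component adj v" "adj\<^sup>* `` {v} \<inter> ({1} \<union> column 1) = {}"
  shows "adj\<^sup>* `` {v - 1} = (\<lambda>w. w - 1) ` (adj\<^sup>* `` {v})" (is ?eq)
    and "two_regular_component adj (v - 1)"
proof -
  let ?p = "\<lambda>w::nat. w - 1"
  have nbr: "adj `` {w - 1} = ?p ` (adj `` {w}) \<and> card (adj `` {w - 1}) = 2"
    if w: "w \<in> adj\<^sup>* `` {v}" for w
  proof -
    have "adj `` {w} \<subseteq> adj\<^sup>* `` {v}" using w by (auto intro: rtrancl_into_rtrancl)
    then have "1 \<notin> adj `` {w}" "w \<notin> {1} \<union> column 1" using w assms(3) by blast+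
    then have sub: "?p ` (adj `` {w}) \<subseteq> adj `` {w - 1}"
      by (intro pred_neighbours_subset)
    have "adj `` {w} \<subseteq> {1..n}" by (auto dest: adj_bounds)
    then have "inj_on ?p (adj `` {w})" using inj_on_pred inj_on_subset by blast
    then have c: "card (?p ` (adj `` {w})) = 2"
      using w assms(2) by (simp add: card_image two_regular_component_def)
    have "?p ` (adj `` {w}) = adj `` {w - 1}"
      using card_neighbours c by (intro card_seteq[OF finite_neighbours sub]) simp
    with c show ?thesis by simp
  qed
  show eq: ?eq by (rule component_image) (use nbr in blast)
  show "two_regular_component adj (v - 1)"
    unfolding two_regular_component_def eq using nbr by blast
qed

lemma component_size_pred:
  assumes "v \<in> {1..n}" "adj\<^sup>* `` {v - 1} = (\<lambda>w. w - 1) ` (adj\<^sup>* `` {v})"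
  shows "component_size (v - 1) = component_size v"
proof -
  have "adj\<^sup>* `` {v} \<subseteq> {1..n}" using component_bounds[OF assms(1)] by blast
  then have "inj_on (\<lambda>w. w - 1) (adj\<^sup>* `` {v})" by (rule inj_on_subset[OF inj_on_pred])
  then show ?thesis unfolding component_size_def assms(2) by (rule card_image)
qed

lemma component_size_eq_if_reachable:
  "(v, w) \<in> adj\<^sup>* \<Longrightarrow> component_size v = component_size w"
  unfolding component_size_def using component_eq_if_reachable[OF sym_adj] by simp

text \<open>
  Shifting lowers \<open>v\<close>, so it must stop, and it stops only when the component meets the border.
\<close>

lemma component_size_border:
  "v \<in> {1..n} \<Longrightarrow> component_size v \<in> component_size ` border"
proof (induction v rule: less_induct)
  case (less v)
  show ?case
  proof (cases "adj\<^sup>* `` {v} \<inter> border = {}")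
    case True
    then have "v \<noteq> 1" by (auto simp: border_def)
    then have "v - 1 < v" "v - 1 \<in> {1..n}" using less.prems by auto
    moreover have "component_size (v - 1) = component_size v"
      using component_size_pred[OF less.prems component_pred[OF less.prems True]] .
    ultimately show ?thesis using less.IH[of "v - 1"] by simp
  next
    case False
    then obtain w where "(v, w) \<in> adj\<^sup>*" "w \<in> border" by blast
    then show ?thesis using component_size_eq_if_reachable by blast
  qed
qed

lemma two_regular_component_size:
  "v \<in> {1..n} \<Longrightarrow> two_regular_component adj v \<Longrightarrow>
    component_size v \<in> component_size ` ({1} \<union> column 1)"
proof (induction v rule: less_induct)
  case (less v)
  show ?case
  proof (cases "adj\<^sup>* `` {v} \<inter> ({1} \<union> column 1) = {}")
    case True
    then have "v \<noteq> 1" by auto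
    then have "v - 1 < v" "v - 1 \<in> {1..n}" using less.prems by auto
    moreover note shift = two_regular_component_pred[OF less.prems True]
    moreover have "component_size (v - 1) = component_size v"
      using component_size_pred[OF less.prems(1) shift(1)] .
    ultimately show ?thesis using less.IH[of "v - 1"] by simp
  next
    case False
    then obtain w where "(v, w) \<in> adj\<^sup>*" "w \<in> {1} \<union> column 1" by blast
    then show ?thesis using component_size_eq_if_reachable by blast
  qed
qed

text \<open>Any two rows with an entry in the same column are adjacent, hence in one component.\<close>

lemma card_component_size_column: "card (component_size ` column k) \<le> 1"
proof -
  have "component_size u = component_size v" if "u \<in> column k" "v \<in> column k" for u v
  proof (cases "u = v")
    case False
    with that have "(u, v) \<in> adj" by (auto simp: adj_def column_def)
    then show ?thesis by (intro component_size_eq_if_reachable) auto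
  qed simp
  then have "\<forall>x\<in>component_size ` column k. \<forall>y\<in>component_size ` column k. x = y" by blast
  moreover have "finite (component_size ` column k)" by (simp add: finite_column)
  ultimately show ?thesis unfolding One_nat_def by (simp only: card_le_Suc0_iff_eq)
qed

lemma card_two_regular_component_sizes:
  "card (component_size ` {v \<in> {1..n}. two_regular_component adj v}) \<le> 2"
proof -
  have "card (component_size ` {v \<in> {1..n}. two_regular_component adj v})
      \<le> card ({component_size 1} \<union> component_size ` column 1)"
    using two_regular_component_size by (intro card_mono) (auto simp: finite_column)
  also have "\<dots> \<le> 1 + 1"
    using card_component_size_column[of 1] by (intro order_trans[OF card_Un_le]) simp
  finally show ?thesis by simp
qed

lemma card_component_sizes: "card (component_size ` {1..n}) \<le> 6"
proof -
  let ?f = component_size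
  have fin: "finite border" by (simp add: border_def finite_column finite_neighbours)
  have shifted: "card (?f ` Suc ` A) \<le> 2" if "finite A" "card A \<le> 2" for A
    using card_image_le[of "Suc ` A" ?f] card_image_le[of A Suc] that by simp
  have "card (?f ` {1..n}) \<le> card (?f ` border)"
    using component_size_border fin by (intro card_mono) auto
  also have "\<dots> = card ({?f 1} \<union> ?f ` column 1 \<union> ?f ` Suc ` column n \<union> ?f ` Suc ` (adj `` {n}))"
    by (simp add: border_def image_Un)
  also have "\<dots> \<le> card {?f 1} + card (?f ` column 1) + card (?f ` Suc ` column n)
      + card (?f ` Suc ` (adj `` {n}))"
    by (intro order_trans[OF card_Un_le] add_mono order_refl)
  also have "\<dots> \<le> 1 + 1 + 2 + 2"
    using card_component_size_column[of 1] shifted[OF finite_column card_column]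
      shifted[OF finite_neighbours card_neighbours] by (intro add_mono) simp_all
  finally show ?thesis by simp
qed

end

section \<open>Toeplitz-row graphs\<close>

lemma toeplitz_matrix_eq_1_iff:
  "toeplitz_matrix \<alpha> \<beta> u v = 1 \<longleftrightarrow> int u - int v \<in> int ` \<alpha> \<union> uminus ` int ` \<beta>"
proof -
  have "int v - int u \<in> int ` \<beta> \<longleftrightarrow> int u - int v \<in> uminus ` int ` \<beta>"
  proof
    assume "int v - int u \<in> int ` \<beta>"
    then have "- (int v - int u) \<in> uminus ` int ` \<beta>" by (rule imageI)
    then show "int u - int v \<in> uminus ` int ` \<beta>" by simp
  next
    assume "int u - int v \<in> uminus ` int ` \<beta>"
    then obtain b where "b \<in> int ` \<beta>" "int u - int v = - b" by (rule imageE)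
    moreover from this have "int v - int u = b" by linarith
    ultimately show "int v - int u \<in> int ` \<beta>" by (simp only:)
  qed
  then show ?thesis unfolding toeplitz_matrix_def Un_iff by (simp only: split: if_split) simp
qed

lemma triangle_freeD:
  assumes "triangle_free G" "x \<in> pverts G" "distinct [x, y, z]"
    and "(x, y) \<in> parcs G" "(y, z) \<in> parcs G" "(z, x) \<in> parcs G"
  shows False
proof -
  have "graph_cycle G [(x, y), (y, z), (z, x)]"
    using assms(2-6) unfolding graph_cycle_def pre_digraph.cycle_def pre_digraph.awalk_def
    by (auto simp: cas_with_proj_eq awalk_verts_with_proj_eq)
  with assms(1) show False unfolding triangle_free_def by force
qed

lemma digraph_iso_with_projE:
  assumes "digraph_iso (with_proj R) (with_proj G)"
  obtains g where "inj_on g (pverts R)" "pverts G = g ` pverts R"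
    "parcs G = map_prod g g ` parcs R"
proof -
  from assms obtain h where h: "pre_digraph.digraph_isomorphism (with_proj R) h"
    and G: "with_proj G = app_iso h (with_proj R)"
    by (auto simp: digraph_iso_def)
  let ?g = "iso_verts h"
  have proj: "iso_tail h = fst" "iso_head h = snd"
    using arg_cong[OF G, of tail] arg_cong[OF G, of head] by simp_all
  have "iso_arcs h a = map_prod ?g ?g a" if "a \<in> parcs R" for a
    using pre_digraph.iso_verts_tail[OF h, of a] pre_digraph.iso_verts_head[OF h, of a] that proj
    by (simp add: prod_eq_iff)
  then have "iso_arcs h ` parcs R = map_prod ?g ?g ` parcs R" by (rule image_cong[OF refl])
  then have "parcs G = map_prod ?g ?g ` parcs R"
    using arg_cong[OF G, of arcs] by simp
  moreover have "pverts G = ?g ` pverts R" using arg_cong[OF G, of verts] by simp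
  moreover have "inj_on ?g (pverts R)"
    using pre_digraph.digraph_isomorphism_inj_on_verts[OF h] by simp
  ultimately show thesis by (intro that)
qed

text \<open>
  Three ones in a column of the matrix make the corresponding three rows a triangle.
\<close>

lemma triangle_free_toeplitz_row_graphE:
  assumes "toeplitz_row_graph G" "triangle_free G"
  obtains n D g where "sparse_toeplitz n D" "inj_on g {1..n}" "pverts G = g ` {1..n}"
    "parcs G = map_prod g g ` sparse_toeplitz.adj n D"
proof -
  from assms(1) obtain n \<alpha> \<beta> where
    iso: "digraph_iso (with_proj (row_graph n (toeplitz_matrix \<alpha> \<beta>))) (with_proj G)"
    by (auto simp: toeplitz_row_graph_def)
  define D where "D = int ` \<alpha> \<union> uminus ` int ` \<beta>"
  let ?R = "row_graph n (toeplitz_matrix \<alpha> \<beta>)"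
  from iso obtain g where g: "inj_on g (pverts ?R)" "pverts G = g ` pverts ?R"
      "parcs G = map_prod g g ` parcs ?R"
    by (rule digraph_iso_with_projE)
  have verts: "pverts ?R = {1..n}" by (simp add: row_graph_def)
  have arcs: "parcs ?R = {(u, v). u \<in> {1..n} \<and> v \<in> {1..n} \<and> u \<noteq> v \<and>
      (\<exists>k\<in>{1..n}. int u - int k \<in> D \<and> int v - int k \<in> D)}"
    unfolding row_graph_def toeplitz_matrix_eq_1_iff D_def by simp
  have sparse: "sparse_toeplitz n D"
  proof (unfold_locales, rule ccontr)
    fix k assume k: "k \<in> {1..n}"
    let ?C = "{u \<in> {1..n}. int u - int k \<in> D}"
    assume "\<not> card ?C \<le> 2"
    then obtain T where "T \<subseteq> ?C" "card T = 3"
      using obtain_subset_with_card_n[of 3 ?C] by auto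
    then obtain x y z where T: "{x, y, z} \<subseteq> ?C" "x \<noteq> y" "x \<noteq> z" "y \<noteq> z"
      unfolding card_3_iff by blast
    have arcI: "(g u, g v) \<in> parcs G" if "u \<in> ?C" "v \<in> ?C" "u \<noteq> v" for u v
    proof -
      have "(u, v) \<in> parcs ?R" using that k unfolding arcs by blast
      then show ?thesis unfolding g(3) by force
    qed
    have "distinct [g x, g y, g z]" 
      using T g(1) unfolding verts by (simp add: inj_on_eq_iff)
    moreover have "g x \<in> pverts G" using T unfolding g(2) verts by blast
    moreover have "(g x, g y) \<in> parcs G" "(g y, g z) \<in> parcs G" "(g z, g x) \<in> parcs G"
      using T by (auto intro!: arcI)
    ultimately show False using triangle_freeD[OF assms(2)] by metis
  qed
  have "(u, v) \<in> parcs ?R \<longleftrightarrow> (u, v) \<in> sparse_toeplitz.adj n D" for u v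
    unfolding arcs sparse_toeplitz.adj_def[OF sparse] sparse_toeplitz.entries_def[OF sparse]
      mem_Collect_eq prod.case by blast
  then have "parcs ?R = sparse_toeplitz.adj n D" by (intro set_eqI) (simp only: split_paired_all)
  with g show thesis unfolding verts by (intro that[OF sparse]) simp_all
qed

text \<open>
  The shift needs the numbering of the vertices by rows, but degrees and component sizes are
  invariant under isomorphism, so the bounds carry over to every graph isomorphic to a row graph.
\<close>

lemma triangle_free_toeplitz_row_graph_properties:
  assumes "toeplitz_row_graph G" "triangle_free G"
  defines "r \<equiv> parcs G"
  shows "pair_graph G"
    and "\<And>x. x \<in> pverts G \<Longrightarrow> card (r `` {x}) \<le> 2"
    and "card ((\<lambda>x. card (r\<^sup>* `` {x})) ` pverts G) \<le> 6"
    and "card ((\<lambda>x. card (r\<^sup>* `` {x})) ` {x \<in> pverts G. two_regular_component r x}) \<le> 2"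
proof -
  from assms(1,2) obtain n D g where sparse: "sparse_toeplitz n D" and inj: "inj_on g {1..n}"
    and verts: "pverts G = g ` {1..n}" and arcs: "parcs G = map_prod g g ` sparse_toeplitz.adj n D"
    by (rule triangle_free_toeplitz_row_graphE)
  interpret sparse_toeplitz n D by (rule sparse)
  have adj_sub: "adj \<subseteq> {1..n} \<times> {1..n}" by (auto dest: adj_bounds)
  have r: "r = map_prod g g ` adj" using arcs by (simp add: r_def)
  show "pair_graph G"
  proof
    show "finite (pverts G)" by (simp add: verts)
    show "finite (parcs G)"
      unfolding arcs by (intro finite_imageI finite_subset[OF adj_sub]) simp
    show "symmetric (with_proj G)"
      using sym_adj by (auto simp: symmetric_def arcs sym_def)
    show "fst e \<in> pverts G" "snd e \<in> pverts G" if "e \<in> parcs G" for e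
      using that adj_sub by (auto simp: verts arcs)
    show "fst e \<noteq> snd e" if "e \<in> parcs G" for e
    proof -
      from that obtain u v where uv: "(u, v) \<in> adj" "e = (g u, g v)" unfolding arcs by auto
      then have "u \<noteq> v" by (simp add: adj_def)
      with uv adj_sub inj show ?thesis by (auto dest: inj_onD)
    qed
  qed
  have nbr: "r `` {g v} = g ` (adj `` {v})" if "v \<in> {1..n}" for v
  proof (intro subset_antisym subsetI)
    fix y assume "y \<in> r `` {g v}"
    then obtain a b where ab: "(a, b) \<in> adj" "g a = g v" "y = g b" unfolding r by auto
    with adj_sub inj that have "a = v" by (auto dest: inj_onD)
    with ab show "y \<in> g ` (adj `` {v})" by blast
  next
    fix y assume "y \<in> g ` (adj `` {v})"
    then obtain b where "(v, b) \<in> adj" "y = g b" by blast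
    then show "y \<in> r `` {g v}" unfolding r by (simp add: map_prod_imageI)
  qed
  have sub: "adj `` {v} \<subseteq> {1..n}" for v using adj_sub by blast
  have card_nbr: "card (r `` {g v}) = card (adj `` {v})" if "v \<in> {1..n}" for v
    unfolding nbr[OF that] using sub inj by (meson card_image inj_on_subset)
  have comp_sub: "adj\<^sup>* `` {v} \<subseteq> {1..n}" if "v \<in> {1..n}" for v
    using component_bounds[OF that] by blast
  have comp: "r\<^sup>* `` {g v} = g ` (adj\<^sup>* `` {v})" if "v \<in> {1..n}" for v
    by (rule component_image, rule nbr) (use component_bounds[OF that] in blast)
  have size: "card (r\<^sup>* `` {g v}) = component_size v" if "v \<in> {1..n}" for v
    unfolding comp[OF that] component_size_def
    using comp_sub[OF that] inj by (meson card_image inj_on_subset)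
  have regular: "two_regular_component r (g v) \<longleftrightarrow> two_regular_component adj v"
    if "v \<in> {1..n}" for v
  proof -
    have "card (r `` {g w}) = card (adj `` {w})" if "w \<in> adj\<^sup>* `` {v}" for w
      using card_nbr comp_sub[OF \<open>v \<in> {1..n}\<close>] that by blast
    then show ?thesis unfolding two_regular_component_def comp[OF that] by simp
  qed
  show "card (r `` {x}) \<le> 2" if "x \<in> pverts G" for x
    using that card_nbr card_neighbours unfolding verts by auto
  have "(\<lambda>x. card (r\<^sup>* `` {x})) ` pverts G = component_size ` {1..n}"
    unfolding verts image_image by (rule image_cong) (simp_all add: size)
  then show "card ((\<lambda>x. card (r\<^sup>* `` {x})) ` pverts G) \<le> 6"
    using card_component_sizes by simp
  have "{x \<in> pverts G. two_regular_component r x} =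
      g ` {v \<in> {1..n}. two_regular_component adj v}"
    unfolding verts using regular by blast
  then have "(\<lambda>x. card (r\<^sup>* `` {x})) ` {x \<in> pverts G. two_regular_component r x} =
      component_size ` {v \<in> {1..n}. two_regular_component adj v}"
    by (simp add: image_image size)
  then show "card ((\<lambda>x. card (r\<^sup>* `` {x})) ` {x \<in> pverts G. two_regular_component r x}) \<le> 2"
    using card_two_regular_component_sizes by simp
qed

section \<open>Cycles and path components\<close>

text \<open>
  The two neighbours that a vertex has on a cycle of length at least 3 are different, so under the
  degree bound they are all its neighbours, and no edge leaves the cycle.
\<close>

lemma graph_cycle_component:
  assumes "pair_graph G" "graph_cycle G p" "\<And>x. x \<in> pverts G \<Longrightarrow> card (parcs G `` {x}) \<le> 2"
  obtains x where "x \<in> pverts G" "two_regular_component (parcs G) x"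
    "card ((parcs G)\<^sup>* `` {x}) = length p"
proof -
  interpret pair_graph G by fact
  let ?r = "parcs G" and ?m = "length p"
  from assms(2) obtain u where u: "awalk u p u" "distinct (tl (awalk_verts u p))" "3 \<le> ?m"
    by (auto simp: graph_cycle_def cycle_def)
  then have ne: "p \<noteq> []" by auto
  have arcs: "set p \<subseteq> ?r" using u(1) by (auto simp: awalk_def)
  have cas: "cas u p u" using u(1) by (simp add: awalk_def)
  define xs where "xs = map snd p"
  have dist: "distinct xs"
    using u(2) ne unfolding awalk_verts_conv'[OF cas] by (simp add: xs_def)
  have len: "length xs = ?m" by (simp add: xs_def)
  have "awalk_verts u p = map fst p @ [snd (last p)]"
    using ne awalk_verts_conv[of u p] by simp
  moreover have "awalk_verts u p = fst (hd p) # xs"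
    using ne awalk_verts_conv'[OF cas] by (simp add: xs_def)
  ultimately have eq: "map fst p @ [snd (last p)] = fst (hd p) # xs" by simp
  \<comment> \<open>The vertices are listed by the heads of the arcs, so \<open>u\<close>, where the walk starts, comes last.\<close>
  have u_eq: "fst (hd p) = u" "snd (last p) = u"
    using cas_simp[OF ne] cas awlast_if_cas[OF cas] awalk_verts_conv[of u p] ne by simp_all
  have arc: "(xs ! i, xs ! (Suc i mod ?m)) \<in> ?r" if "i < ?m" for i
  proof (cases "Suc i < ?m")
    case True
    then have "fst (p ! Suc i) = xs ! i"
      using arg_cong[OF eq, of "\<lambda>l. l ! Suc i"] by (simp add: nth_append)
    then have "p ! Suc i = (xs ! i, xs ! Suc i)" using True by (simp add: xs_def prod_eq_iff)
    moreover have "p ! Suc i \<in> ?r" using True arcs nth_mem by blast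
    ultimately show ?thesis using True by simp
  next
    case False
    with that have i: "Suc i = ?m" by simp
    then have "i = ?m - 1" by simp
    then have "xs ! i = u" using u_eq ne by (simp add: xs_def last_conv_nth)
    then have "p ! 0 = (xs ! i, xs ! 0)"
      using u_eq ne by (simp add: xs_def prod_eq_iff hd_conv_nth)
    moreover have "p ! 0 \<in> ?r" using ne arcs nth_mem by blast
    ultimately show ?thesis using i by simp
  qed
  have sym: "sym ?r" using sym_arcs by (simp add: symmetric_def)
  have nbrs: "card (?r `` {x}) = 2 \<and> ?r `` {x} \<subseteq> set xs" if "x \<in> set xs" for x
  proof -
    from that obtain i where i: "i < ?m" "x = xs ! i" using len by (auto simp: in_set_conv_nth)
    define j where "j = (if i = 0 then ?m - 1 else i - 1)"
    define k where "k = Suc i mod ?m"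
    have jk: "j < ?m" "k < ?m" "Suc j mod ?m = i" "j \<noteq> k"
      using i(1) u(3) by (auto simp: j_def k_def mod_Suc)
    have "(xs ! j, xs ! i) \<in> ?r" using arc[OF jk(1)] jk(3) by simp
    then have sub: "{xs ! j, xs ! k} \<subseteq> ?r `` {x}"
      using arc[OF i(1)] sym i(2) by (auto simp: k_def dest: symD)
    have "xs ! j \<noteq> xs ! k" using jk dist len by (simp add: nth_eq_iff_index_eq)
    then have c: "card {xs ! j, xs ! k} = 2" by simp
    have "x \<in> pverts G" using sub by (auto dest: in_arcsD1)
    moreover have "finite (?r `` {x})"
      by (rule finite_subset[of _ "pverts G"]) (auto dest: in_arcsD2)
    ultimately have "{xs ! j, xs ! k} = ?r `` {x}"
      using sub c assms(3) by (intro card_seteq) simp_all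
    moreover have "{xs ! j, xs ! k} \<subseteq> set xs" using jk len by simp
    ultimately show ?thesis using c by simp
  qed
  have reach: "i < ?m \<Longrightarrow> (xs ! 0, xs ! i) \<in> ?r\<^sup>*" for i
  proof (induction i)
    case (Suc i)
    then have "(xs ! i, xs ! Suc i) \<in> ?r" using arc[of i] by simp
    with Suc show ?case by (meson Suc_lessD rtrancl_into_rtrancl)
  qed simp
  have comp: "?r\<^sup>* `` {xs ! 0} = set xs"
  proof (rule component_eq_closed_connected)
    show "?r `` set xs \<subseteq> set xs" using nbrs by blast
    show "set xs \<subseteq> ?r\<^sup>* `` {xs ! 0}" using reach len by (auto simp: in_set_conv_nth)
    show "xs ! 0 \<in> set xs" using ne len by simp
  qed
  show thesis
  proof
    show "xs ! 0 \<in> pverts G" using arc[of 0] ne by (auto dest: in_arcsD1)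
    show "two_regular_component ?r (xs ! 0)"
      unfolding two_regular_component_def comp using nbrs by blast
    show "card (?r\<^sup>* `` {xs ! 0}) = ?m"
      unfolding comp using distinct_card[OF dist] len by simp
  qed
qed

text \<open>
  The subgraph induced on the vertices reachable from \<open>x\<close> is connected and contains \<open>H\<close>, so it is
  \<open>H\<close> by maximality.
\<close>

lemma graph_component_verts:
  assumes "pair_graph G" "graph_component G H" "x \<in> verts H"
  shows "x \<in> pverts G" "verts H = (parcs G)\<^sup>* `` {x}"
proof -
  interpret pair_graph G by fact
  let ?r = "parcs G"
  have sub: "subgraph H G" and conn: "connected H"
    and max: "\<And>H'. H' \<noteq> H \<Longrightarrow> subgraph H H' \<Longrightarrow> subgraph H' G \<Longrightarrow> \<not> connected H'"
    using assms(2) unfolding graph_component_def max_subgraph_def by auto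
  show x: "x \<in> pverts G" using sub assms(3) by (auto simp: subgraph_def)
  have sym: "sym ?r" using sym_arcs by (simp add: symmetric_def)
  have ends: "arcs_ends H \<subseteq> ?r"
    using sub by (auto simp: subgraph_def compatible_def arcs_ends_def arc_to_ends_def)
  have inside: "verts H \<subseteq> ?r\<^sup>* `` {x}"
  proof
    fix y assume "y \<in> verts H"
    then have "(x, y) \<in> rtrancl_on (verts H) ((arcs_ends H)\<^sup>s)"
      using conn assms(3) by (simp add: connected_conv)
    moreover have "(arcs_ends H)\<^sup>s \<subseteq> ?r"
      using ends sym by (auto simp: symcl_def dest: symD)
    ultimately show "y \<in> ?r\<^sup>* `` {x}"
      by (auto dest: rtrancl_on_rtranclI intro: rtrancl_mono[THEN subsetD])
  qed
  let ?C = "with_proj G \<restriction> {v. x \<rightarrow>\<^sup>*\<^bsub>with_proj G\<^esub> v}"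
  have reach: "{v. x \<rightarrow>\<^sup>*\<^bsub>with_proj G\<^esub> v} = ?r\<^sup>* `` {x}"
  proof -
    have "y \<in> pverts G" if "(x, y) \<in> ?r\<^sup>*" for y
      using that x by (metis rtranclE in_arcsD2)
    then show ?thesis using x by (auto simp: reachable_conv)
  qed
  have sccs: "?C \<in> sccs" by (rule induce_reachable_is_in_sccs) (simp add: x)
  then have C: "subgraph ?C G" "strongly_connected ?C"
    by (auto simp: sccs_def dest: induced_imp_subgraph)
  have "connected ?C"
    unfolding connected_conv
  proof (intro conjI ballI)
    show "verts ?C \<noteq> {}" using C(2) by (simp add: strongly_connected_def)
    fix y z assume "y \<in> verts ?C" "z \<in> verts ?C"
    then have "(y, z) \<in> rtrancl_on (verts ?C) (arcs_ends ?C)"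
      using C(2) unfolding strongly_connected_def reachable_def by blast
    then show "(y, z) \<in> rtrancl_on (verts ?C) ((arcs_ends ?C)\<^sup>s)"
      by (rule rtrancl_on_mono[OF _ subset_refl, rotated]) (simp add: symcl_def)
  qed
  moreover have "subgraph H ?C"
  proof -
    have "verts H \<subseteq> verts ?C" using inside reach by simp
    moreover have "wf_digraph ?C" using C(1) by (simp add: subgraph_def)
    ultimately show ?thesis
      using sub wf_digraph.wellformed[of H] by (auto simp: subgraph_def compatible_def subset_iff)
  qed
  ultimately have "?C = H" using max C(1) by blast
  then have "verts ?C = verts H" by (rule arg_cong)
  then show "verts H = ?r\<^sup>* `` {x}" unfolding induce_subgraph_verts reach by (simp only:)
qed

lemma path_component:
  assumes "pair_graph G" "graph_component G H" "is_path_of_length H l"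
  obtains x where "x \<in> pverts G" "card ((parcs G)\<^sup>* `` {x}) = Suc l"
proof -
  from assms(3) obtain u p v where p: "pre_digraph.apath H u p v" "length p = l"
      "verts H = set (pre_digraph.awalk_verts H u p)"
    unfolding is_path_of_length_def by blast
  from p(1) have "distinct (pre_digraph.awalk_verts H u p)" "u \<in> verts H"
    by (simp_all add: pre_digraph.apath_def pre_digraph.awalk_def)
  then have "card (verts H) = Suc l"
    using p(2,3) by (simp add: distinct_card pre_digraph.length_awalk_verts)
  then show thesis
    using graph_component_verts[OF assms(1,2) \<open>u \<in> verts H\<close>] that by simp
qed

theorem theorem2p10:
  fixes G :: "'a pair_pre_digraph"
  assumes "toeplitz_row_graph G" and "triangle_free G"
  shows "(\<nexists>C :: nat \<Rightarrow> ('a \<times> 'a) list.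
            (\<forall>i<3. graph_cycle G (C i)) \<and> inj_on (\<lambda>i. length (C i)) {..<3}) \<and>
         (\<nexists>(H :: nat \<Rightarrow> ('a, 'a \<times> 'a) pre_digraph) (l :: nat \<Rightarrow> nat).
            (\<forall>i<7. graph_component G (H i) \<and> is_path_of_length (H i) (l i)) \<and> inj_on l {..<7})"
proof (intro conjI notI; elim exE conjE)
  let ?r = "parcs G"
  let ?size = "\<lambda>x. card (?r\<^sup>* `` {x})"
  note G = triangle_free_toeplitz_row_graph_properties[OF assms]
  have fin: "finite (pverts G)" 
  proof -
    interpret pair_graph G by (rule G(1))
    show ?thesis by (rule pair_finite_verts)
  qed
  {
    fix C :: "nat \<Rightarrow> ('a \<times> 'a) list"
    assume C: "\<forall>i<3. graph_cycle G (C i)" and inj: "inj_on (\<lambda>i. length (C i)) {..<3}"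
    have "(\<lambda>i. length (C i)) ` {..<3} \<subseteq> ?size ` {x \<in> pverts G. two_regular_component ?r x}"
    proof clarify
      fix i :: nat assume "i < 3"
      with C have "graph_cycle G (C i)" by blast
      from graph_cycle_component[OF G(1) this G(2)] obtain x where
        "x \<in> pverts G" "two_regular_component ?r x" "?size x = length (C i)" .
      then show "length (C i) \<in> ?size ` {x \<in> pverts G. two_regular_component ?r x}"
        by (auto intro: rev_image_eqI)
    qed
    then have "card {..<3::nat} \<le> card (?size ` {x \<in> pverts G. two_regular_component ?r x})"
      using fin by (intro card_inj_on_le[OF inj]) simp_all
    with G(4) show False by simp
  next
    fix H :: "nat \<Rightarrow> ('a, 'a \<times> 'a) pre_digraph" and l :: "nat \<Rightarrow> nat"
    assume H: "\<forall>i<7. graph_component G (H i) \<and> is_path_of_length (H i) (l i)"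
      and inj: "inj_on l {..<7}"
    have "(\<lambda>i. Suc (l i)) ` {..<7} \<subseteq> ?size ` pverts G"
    proof clarify
      fix i :: nat assume "i < 7"
      with H have "graph_component G (H i)" "is_path_of_length (H i) (l i)" by blast+
      from path_component[OF G(1) this] obtain x where "x \<in> pverts G" "?size x = Suc (l i)" .
      then show "Suc (l i) \<in> ?size ` pverts G" by (auto intro: rev_image_eqI)
    qed
    moreover have "inj_on (\<lambda>i. Suc (l i)) {..<7}" using inj by (simp add: inj_on_def)
    ultimately have "card {..<7::nat} \<le> card (?size ` pverts G)"
      using fin by (intro card_inj_on_le) simp_all
    with G(3) show False by simp
  }
qed

end
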